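(* Let $S$ be a numerical semigroup with multiplicity six. (a) If $S$ has a decomposition into irreducibles of length $5$, then $S$ has a decomposition into irreducibles of length $4$. (b) If $S$ has a decomposition into irreducibles of length $4$, then $S$ has a decomposition into irreducibles of length $3$. In particular, the set of decomposition lengths of $S$ is an interval.
   Context: A numerical semigroup is a subset of $\mathbb{Z}_{\ge 0}$ that contains $0$, is closed under addition, and has finite complement in $\mathbb{Z}_{\ge 0}$. The multiplicity of a numerical semigroup is its smallest positive element. A numerical semigroup is irreducible if it cannot be expressed as the intersection of two numerical semigroups properly containing it. A decomposition of $S$ into irreducibles is an expression $S = S_1 \cap \cdots \cap S_k$ with each $S_i$ an irreducible numerical semigroup, which is irredundant: $S \ne \bigcap_{i \in I} S_i$ for every proper subset $I \subsetneq \{1,\dots,k\}$. The number $k$ is the length of the decomposition. The set of decomposition lengths of $S$ is the set of all $k$ for which $S$ has a decomposition into irreducibles of length $k$. A set of integers is an interval if it has the form $\{n \in \mathbb{Z} : a \le n \le b\}$ for some integers $a \le b$. *)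

theory Defs
  imports Main
begin

definition numerical_semigroup :: "nat set \<Rightarrow> bool" where
  "numerical_semigroup S \<longleftrightarrow>
     0 \<in> S \<and> (\<forall>x\<in>S. \<forall>y\<in>S. x + y \<in> S) \<and> finite (UNIV - S)"

definition multiplicity :: "nat set \<Rightarrow> nat" where
  "multiplicity S = (LEAST n. n \<in> S \<and> 0 < n)"

definition irreducible_semigroup :: "nat set \<Rightarrow> bool" where
  "irreducible_semigroup S \<longleftrightarrow>
     numerical_semigroup S \<and>
     \<not> (\<exists>T U. numerical_semigroup T \<and> numerical_semigroup U \<and>
              S \<subset> T \<and> S \<subset> U \<and> S = T \<inter> U)"

text \<open>
  Only the values of the family on the index set \<open>{1..k}\<close> matter. The intersection over the
  empty index set is the set of all natural numbers; this convention plays a role only for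
  \<open>S = UNIV\<close>.
\<close>

definition irreducible_decomposition :: "nat set \<Rightarrow> nat \<Rightarrow> (nat \<Rightarrow> nat set) \<Rightarrow> bool" where
  "irreducible_decomposition S k F \<longleftrightarrow>
     (\<forall>i\<in>{1..k}. irreducible_semigroup (F i)) \<and>
     S = (\<Inter>i\<in>{1..k}. F i) \<and>
     (\<forall>I. I \<subset> {1..k} \<longrightarrow> S \<noteq> (\<Inter>i\<in>I. F i))"

definition decomposition_lengths :: "nat set \<Rightarrow> nat set" where
  "decomposition_lengths S = {k. \<exists>F. irreducible_decomposition S k F}"

definition integer_interval :: "int set \<Rightarrow> bool" where
  "integer_interval A \<longleftrightarrow> (\<exists>a b. a \<le> b \<and> A = {n. a \<le> n \<and> n \<le> b})"

end

theory Submission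
  imports Defs
begin

text \<open>
  A special gap of \<open>S\<close> is a gap \<open>h\<close> for which \<open>S \<union> {h}\<close> is again a semigroup. Since the largest
  element of \<open>T - S\<close> is a special gap for every semigroup \<open>T \<supset> S\<close>, decompositions of \<open>S\<close> are the
  irredundant covers of the set of special gaps by the sets of special gaps missed by irreducible
  oversemigroups. In multiplicity six the special gaps have distinct nonzero residues modulo 6, so
  there are at most five of them.

  An irreducible oversemigroup missing exactly two special gaps \<open>b < a\<close> is found by adjoining the
  other special gaps and \<open>a - b\<close> to \<open>S\<close>, and then enlarging maximally subject to missing \<open>a\<close>. This
  always works when \<open>a\<close> and \<open>b\<close> differ by 3 modulo 6 and neither is generated by the others. If a
  cover has as many members as there are special gaps, then each member misses only one of them and
  two members whose gaps have residues 1, 4 or 2, 5 can be merged. If there are five special gaps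
  and four members, then each member misses at most two, and it suffices to find two disjoint pairs:
  the residues \<open>{1,4}\<close>, \<open>{2,5}\<close> serve unless \<open>h\<^sub>2 + h\<^sub>5 = h\<^sub>1\<close>, when \<open>{1,2}\<close>, \<open>{3,5}\<close> do, or, symmetrically,
  \<open>h\<^sub>4 + h\<^sub>1 = h\<^sub>5\<close>.
\<close>

section \<open>Special gaps and covers of them\<close>

definition special_gaps :: "nat set \<Rightarrow> nat set" where
  "special_gaps S = {h. h \<notin> S \<and> h + h \<in> S \<and> (\<forall>s\<in>S. 0 < s \<longrightarrow> h + s \<in> S)}"

text \<open>The last clause is irredundance read off on special gaps: every member has a private
  gap, missed by it and by no other member. Members form a set, so that the length becomes a
  cardinality.\<close>

definition irredundant_cover :: "nat set \<Rightarrow> nat set set \<Rightarrow> bool" where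
  "irredundant_cover S G \<longleftrightarrow>
     finite G \<and> (\<forall>T\<in>G. irreducible_semigroup T \<and> S \<subseteq> T) \<and>
     (\<forall>h\<in>special_gaps S. \<exists>T\<in>G. h \<notin> T) \<and>
     (\<forall>T\<in>G. \<exists>h\<in>special_gaps S. h \<notin> T \<and> (\<forall>U\<in>G - {T}. h \<in> U))"

section \<open>Closure properties of numerical semigroups\<close>

lemma semigroup_zero: "numerical_semigroup S \<Longrightarrow> 0 \<in> S"
  by (simp add: numerical_semigroup_def)

lemma semigroup_add: "numerical_semigroup S \<Longrightarrow> x \<in> S \<Longrightarrow> y \<in> S \<Longrightarrow> x + y \<in> S"
  by (simp add: numerical_semigroup_def)

lemma semigroup_mult:
  assumes "numerical_semigroup S" "x \<in> S"
  shows "n * x \<in> S"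
  by (induction n) (use assms in \<open>auto intro: semigroup_zero semigroup_add\<close>)

lemma semigroup_finite: "numerical_semigroup S \<Longrightarrow> finite (- S)"
  by (simp add: numerical_semigroup_def Compl_eq_Diff_UNIV)

lemma numerical_semigroupI:
  assumes "0 \<in> T" "\<And>x y. x \<in> T \<Longrightarrow> y \<in> T \<Longrightarrow> x + y \<in> T" "numerical_semigroup S" "S \<subseteq> T"
  shows "numerical_semigroup T"
proof -
  have "finite (- T)"
    using semigroup_finite[OF assms(3)] assms(4) by (meson Compl_anti_mono finite_subset)
  then show ?thesis using assms(1,2) by (simp add: numerical_semigroup_def Compl_eq_Diff_UNIV)
qed

lemma numerical_semigroup_Int:
  assumes "numerical_semigroup S" "numerical_semigroup T"
  shows "numerical_semigroup (S \<inter> T)"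
  using assms by (auto simp: numerical_semigroup_def Diff_Int)

lemma semigroup_mod_6:
  assumes S: "numerical_semigroup S" "6 \<in> S" and "s \<in> S" "s \<le> x" "s mod 6 = x mod 6"
  shows "x \<in> S"
proof -
  obtain k where "x = s + k * 6"
    using assms(4,5) by (metis le_add_diff_inverse mod_eq_dvd_iff_nat dvd_def mult.commute)
  then show ?thesis using assms semigroup_mult semigroup_add by metis
qed

section \<open>Special gaps and oversemigroups\<close>

lemma special_gapD:
  assumes "h \<in> special_gaps S"
  shows "h \<notin> S" "h + h \<in> S" "s \<in> S \<Longrightarrow> 0 < s \<Longrightarrow> h + s \<in> S"
  using assms by (auto simp: special_gaps_def)

text \<open>Doubles of special gaps and their sums with elements of \<open>S\<close> are harmless by
  definition, so only sums of two distinct adjoined gaps need a hypothesis.\<close>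

lemma special_gaps_union:
  assumes S: "numerical_semigroup S" and J: "J \<subseteq> special_gaps S"
    and sum: "\<And>i j. i \<in> J \<Longrightarrow> j \<in> J \<Longrightarrow> i \<noteq> j \<Longrightarrow> i + j \<in> S \<union> J"
  shows "numerical_semigroup (S \<union> J)"
proof (rule numerical_semigroupI[OF _ _ S])
  show "0 \<in> S \<union> J" using S by (simp add: semigroup_zero)
next
  have *: "h + s \<in> S \<union> J" if "h \<in> J" "s \<in> S" for h s
    using that J by (cases "s = 0") (auto simp: special_gaps_def)
  show "x + y \<in> S \<union> J" if "x \<in> S \<union> J" "y \<in> S \<union> J" for x y
  proof (cases "x \<in> S")
    case True
    then show ?thesis using that *[of y x] S by (auto simp: add.commute semigroup_add)
  next
    case False
    then show ?thesis
      using that *[of x y] sum[of x y] J by (cases "x = y") (auto simp: special_gaps_def)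
  qed
qed simp

lemma special_gap_of_superset:
  assumes S: "numerical_semigroup S" and T: "numerical_semigroup T" and "S \<subset> T"
  shows "\<exists>h\<in>special_gaps S. h \<in> T"
proof -
  have fin: "finite (T - S)"
    using semigroup_finite[OF S] by (rule rev_finite_subset) auto
  define h where "h = Max (T - S)"
  have h: "h \<in> T" "h \<notin> S"
    using Max_in[OF fin] \<open>S \<subset> T\<close> by (auto simp: h_def)
  then have "0 < h" using S semigroup_zero by (metis gr0I)
  have max: "h + x \<in> S" if "x \<in> T" "0 < x" for x
  proof (rule ccontr)
    assume "h + x \<notin> S"
    then have "h + x \<in> T - S" using h that T by (simp add: semigroup_add)
    then have "h + x \<le> h" unfolding h_def using fin by (intro Max_ge)
    then show False using \<open>0 < x\<close> by simp
  qed
  then have "h \<in> special_gaps S"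
    using h \<open>0 < h\<close> \<open>S \<subset> T\<close> by (auto simp: special_gaps_def)
  then show ?thesis using h by blast
qed

text \<open>The intersection is itself a semigroup above \<open>S\<close>; if it were strictly
  larger, it would contain a special gap, missed by no member.\<close>

lemma Inter_eq_iff_special_gaps:
  assumes S: "numerical_semigroup S" and "finite I"
    and F: "\<And>i. i \<in> I \<Longrightarrow> numerical_semigroup (F i) \<and> S \<subseteq> F i"
  shows "S = (\<Inter>i\<in>I. F i) \<longleftrightarrow> (\<forall>h\<in>special_gaps S. \<exists>i\<in>I. h \<notin> F i)"
proof
  assume "S = (\<Inter>i\<in>I. F i)"
  then show "\<forall>h\<in>special_gaps S. \<exists>i\<in>I. h \<notin> F i"
    by (auto simp: special_gaps_def)
next
  assume cover: "\<forall>h\<in>special_gaps S. \<exists>i\<in>I. h \<notin> F i"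
  have T: "numerical_semigroup (\<Inter>i\<in>I. F i)"
    using F by (intro numerical_semigroupI[OF _ _ S]) (auto simp: semigroup_zero semigroup_add)
  have "\<not> S \<subset> (\<Inter>i\<in>I. F i)"
  proof
    assume "S \<subset> (\<Inter>i\<in>I. F i)"
    from special_gap_of_superset[OF S T this] show False using cover by blast
  qed
  moreover have "S \<subseteq> (\<Inter>i\<in>I. F i)" using F by (intro INT_greatest) simp
  ultimately show "S = (\<Inter>i\<in>I. F i)" by (simp add: psubset_eq)
qed

section \<open>Irreducible oversemigroups missing prescribed gaps\<close>

text \<open>Only finitely many oversemigroups avoid \<open>a\<close>, since \<open>S\<close> has
  finitely many gaps. A maximal one is irreducible: all semigroups properly above it contain
  \<open>a\<close>, hence so do their intersections.\<close>

lemma irreducible_extension: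
  assumes S: "numerical_semigroup S" and "a \<notin> S"
  obtains T where "irreducible_semigroup T" "S \<subseteq> T" "a \<notin> T"
proof -
  define A where "A = {T. numerical_semigroup T \<and> S \<subseteq> T \<and> a \<notin> T}"
  have "A \<subseteq> (\<lambda>X. - X) ` Pow (- S)"
  proof
    fix T assume "T \<in> A"
    then have "T = - (- T)" "- T \<in> Pow (- S)" by (auto simp: A_def)
    then show "T \<in> (\<lambda>X. - X) ` Pow (- S)" by blast
  qed
  then have "finite A"
    using semigroup_finite[OF S] by (meson finite_Pow_iff finite_imageI finite_subset)
  moreover have "S \<in> A" using assms by (simp add: A_def)
  ultimately obtain T where T: "T \<in> A" "\<And>U. U \<in> A \<Longrightarrow> T \<subseteq> U \<Longrightarrow> T = U"
    using finite_has_maximal[of A] by blast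
  have "irreducible_semigroup T"
    unfolding irreducible_semigroup_def
  proof (intro conjI notI)
    show "numerical_semigroup T" using T(1) by (simp add: A_def)
    assume "\<exists>U V. numerical_semigroup U \<and> numerical_semigroup V \<and> T \<subset> U \<and> T \<subset> V \<and> T = U \<inter> V"
    then obtain U V where UV: "numerical_semigroup U" "numerical_semigroup V" "T \<subset> U" "T \<subset> V" "T = U \<inter> V"
      by blast
    have "a \<in> U" "a \<in> V" using UV T T(2)[of U] T(2)[of V] by (auto simp: A_def)
    then show False using UV T(1) by (auto simp: A_def)
  qed
  then show thesis using that T(1) by (auto simp: A_def)
qed

text \<open>The hypothesis on \<open>m\<close> keeps \<open>a\<close> out of the semigroup generated
  by \<open>S\<close> and \<open>a - b\<close>: writing \<open>a\<close> with \<open>m + 1\<close>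
  copies of \<open>a - b\<close> leaves \<open>b - m * (a - b)\<close> as the part in
  \<open>S\<close>. The bound \<open>m * (a - b) \<le> b\<close> guards against truncated
  subtraction, which would give \<open>0 \<in> S\<close>.\<close>

lemma irreducible_missing_pair:
  assumes S: "numerical_semigroup S" and "a \<notin> S" "b \<notin> S" "b < a"
    and desc: "\<And>m. 0 < m \<Longrightarrow> m * (a - b) \<le> b \<Longrightarrow> b - m * (a - b) \<notin> S"
  obtains T where "irreducible_semigroup T" "S \<subseteq> T" "a \<notin> T" "b \<notin> T"
proof -
  \<comment> \<open>An oversemigroup containing \<open>a - b\<close> but not \<open>a\<close> cannot contain \<open>b\<close>.\<close>
  define T where "T = {s + n * (a - b) | s n. s \<in> S}"
  have ST: "S \<subseteq> T"
  proof
    fix s assume "s \<in> S"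
    then have "s + 0 * (a - b) \<in> T" unfolding T_def by blast
    then show "s \<in> T" by simp
  qed
  have "numerical_semigroup T"
  proof (rule numerical_semigroupI[OF _ _ S ST])
    show "0 \<in> T" using ST S semigroup_zero by blast
    fix x y assume "x \<in> T" "y \<in> T"
    then obtain s n t m where "x = s + n * (a - b)" "s \<in> S" "y = t + m * (a - b)" "t \<in> S"
      by (auto simp: T_def)
    then have "x + y = (s + t) + (n + m) * (a - b)" "s + t \<in> S"
      using S by (auto simp: algebra_simps semigroup_add)
    then show "x + y \<in> T" unfolding T_def by blast
  qed
  moreover have "a \<notin> T"
  proof
    assume "a \<in> T"
    then obtain s n where sn: "a = s + n * (a - b)" "s \<in> S" by (auto simp: T_def)
    then obtain m where m: "n = Suc m" using \<open>a \<notin> S\<close> by (cases n) auto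
    then have "b = s + m * (a - b)" using sn \<open>b < a\<close> by simp
    then have "s = b - m * (a - b)" "m * (a - b) \<le> b" by simp_all
    then show False using sn desc[of m] \<open>b \<notin> S\<close> by (cases "m = 0") auto
  qed
  ultimately obtain U where U: "irreducible_semigroup U" "T \<subseteq> U" "a \<notin> U"
    using irreducible_extension by blast
  have "0 + 1 * (a - b) \<in> T" unfolding T_def using S semigroup_zero by blast
  then have "a - b \<in> U" using U by auto
  moreover have "numerical_semigroup U" using U by (simp add: irreducible_semigroup_def)
  ultimately have "b \<notin> U" using U \<open>b < a\<close> semigroup_add[of U b "a - b"] by auto
  then show thesis using that U ST by blast
qed

lemma mod_add_cancel:
  fixes x y a n :: nat
  shows "(x + a) mod n = (y + a) mod n \<longleftrightarrow> x mod n = y mod n"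
  by (simp add: nat_mod_eq_iff)

text \<open>For \<open>b < a\<close>, each \<open>b - m * (a - b)\<close> is congruent to
  \<open>a\<close> or \<open>b\<close> and is at most \<open>b\<close>; if it were in
  \<open>S\<close>, adding sixes would put \<open>a\<close> or \<open>b\<close> into
  \<open>S\<close>. The congruence is symmetric in \<open>a\<close> and \<open>b\<close>, so the
  other order follows by swapping.\<close>

lemma irreducible_missing_antipodal_pair:
  assumes S: "numerical_semigroup S" "6 \<in> S" and "a \<notin> S" "b \<notin> S"
    and mod: "(a + 3) mod 6 = b mod 6"
  obtains T where "irreducible_semigroup T" "S \<subseteq> T" "a \<notin> T" "b \<notin> T"
proof -
  have *: "\<exists>T. irreducible_semigroup T \<and> S \<subseteq> T \<and> a \<notin> T \<and> b \<notin> T"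
    if "a \<notin> S" "b \<notin> S" "b < a" and ab: "(a + 3) mod 6 = b mod 6" for a b
  proof -
    \<comment> \<open>The residue of \<open>a - b\<close> is found by adding and cancelling, which
      avoids truncated subtraction.\<close>
    have "((a - b + 3) + b) mod 6 = (0 + b) mod 6" using ab \<open>b < a\<close> by simp
    then have "(a - b + 3) mod 6 = (3 + 3) mod 6" by (simp only: mod_add_cancel) simp
    then have x: "(a - b) mod 6 = 3" by (simp only: mod_add_cancel) simp
    have "b - m * (a - b) \<notin> S" if m: "0 < m" "m * (a - b) \<le> b" for m
    proof
      define d where "d = m * (a - b)"
      assume "b - m * (a - b) \<in> S"
      then have s: "b - d \<in> S" by (simp add: d_def)
      have "d \<le> b" using m by (simp add: d_def)
      have "d mod 6 = (m * 3) mod 6" unfolding d_def by (metis x mod_mult_right_eq)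
      then have "d mod 6 = 0 \<or> d mod 6 = 3" by presburger
      then have "(b - d) mod 6 = b mod 6 \<or> (b - d) mod 6 = a mod 6"
      proof
        assume "d mod 6 = 0"
        then have "((b - d) + d) mod 6 = (b - d) mod 6" by (metis add.right_neutral mod_add_right_eq)
        then show ?thesis using \<open>d \<le> b\<close> by simp
      next
        assume "d mod 6 = 3"
        then have "((b - d) + d) mod 6 = ((b - d) + 3) mod 6" by (metis mod_add_right_eq)
        then have "((b - d) + 3) mod 6 = (a + 3) mod 6" using \<open>d \<le> b\<close> ab by simp
        then show ?thesis by (simp add: mod_add_cancel)
      qed
      then show False
        using semigroup_mod_6[OF S s, of a] semigroup_mod_6[OF S s, of b] \<open>b < a\<close>
          \<open>a \<notin> S\<close> \<open>b \<notin> S\<close> by (meson diff_le_self le_trans less_imp_le_nat)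
    qed
    then show ?thesis using irreducible_missing_pair[OF S(1)] that by metis
  qed
  have "a \<noteq> b"
  proof
    assume "a = b"
    then have "(3 + b) mod 6 = (0 + b) mod 6" using mod by (simp add: add.commute)
    then show False by (simp only: mod_add_cancel) simp
  qed
  moreover have "(b + 3) mod 6 = (a + 3 + 3) mod 6" using mod by (metis mod_add_left_eq)
  then have "(b + 3) mod 6 = a mod 6" by simp
  ultimately show thesis using *[of a b] *[of b a] assms that by (metis nat_neq_iff)
qed

section \<open>Residues of special gaps modulo 6\<close>

lemma finite_special_gaps: "numerical_semigroup S \<Longrightarrow> finite (special_gaps S)"
  using semigroup_finite by (rule rev_finite_subset) (auto simp: special_gaps_def)

text \<open>The larger of two congruent special gaps would be the smaller one plus a positive
  multiple of 6, hence in \<open>S\<close>. Residue 0 is excluded because \<open>S\<close> contains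
  all multiples of 6.\<close>

lemma special_gaps_mod_6:
  assumes S: "numerical_semigroup S" "6 \<in> S"
  shows "inj_on (\<lambda>h. h mod 6) (special_gaps S)"
    and "(\<lambda>h. h mod 6) ` special_gaps S \<subseteq> {1..5}"
proof -
  have *: "\<not> h < k" if "h \<in> special_gaps S" "k \<in> special_gaps S" "h mod 6 = k mod 6" for h k
  proof
    assume "h < k"
    then have "6 dvd k - h" using that(3) by (metis less_imp_le_nat mod_eq_dvd_iff_nat)
    then obtain i where "k - h = i * 6" by (metis dvd_def mult.commute)
    then have "k = h + i * 6" "i * 6 \<in> S" "0 < i * 6"
      using \<open>h < k\<close> semigroup_mult[OF S] by auto
    then have "k \<in> S" using that(1) by (auto simp: special_gaps_def)
    then show False using that by (simp add: special_gaps_def)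
  qed
  then show "inj_on (\<lambda>h. h mod 6) (special_gaps S)"
    by (intro inj_onI) (metis nat_neq_iff)
  show "(\<lambda>h. h mod 6) ` special_gaps S \<subseteq> {1..5}"
  proof safe
    fix h assume h: "h \<in> special_gaps S"
    have "h mod 6 \<noteq> 0"
      using h semigroup_mod_6[OF S semigroup_zero[OF S(1)], of h] by (auto simp: special_gaps_def)
    moreover have "h mod 6 < 6" by simp
    ultimately show "h mod 6 \<in> {1..5}" unfolding atLeastAtMost_iff by linarith
  qed
qed

lemma card_special_gaps_le:
  assumes "numerical_semigroup S" "6 \<in> S"
  shows "card (special_gaps S) \<le> 5"
  using card_inj_on_le[OF special_gaps_mod_6[OF assms]] by simp

section \<open>Decompositions as irredundant covers\<close>

text \<open>Fixes a private gap \<open>p T\<close> for each member. As \<open>p T\<close> lies in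
  every other member, \<open>p\<close> is injective, and members can be counted by gaps.\<close>

lemma irredundant_cover_private:
  assumes "irredundant_cover S G"
  obtains p where "inj_on p G" "p ` G \<subseteq> special_gaps S"
    "\<And>T. T \<in> G \<Longrightarrow> p T \<notin> T" "\<And>T U. T \<in> G \<Longrightarrow> U \<in> G \<Longrightarrow> U \<noteq> T \<Longrightarrow> p T \<in> U"
proof -
  have "\<forall>T\<in>G. \<exists>h. h \<in> special_gaps S \<and> h \<notin> T \<and> (\<forall>U\<in>G - {T}. h \<in> U)"
    using assms by (auto simp: irredundant_cover_def)
  then obtain p where p: "\<forall>T\<in>G. p T \<in> special_gaps S \<and> p T \<notin> T \<and> (\<forall>U\<in>G - {T}. p T \<in> U)"
    by metis
  have "inj_on p G"
  proof (rule inj_onI)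
    fix T U assume "T \<in> G" "U \<in> G" "p T = p U"
    then show "T = U" using p by (metis DiffI singletonD)
  qed
  then show thesis using p by (intro that[of p]) auto
qed

lemma irredundant_cover_card_le:
  assumes "numerical_semigroup S" "irredundant_cover S G"
  shows "card G \<le> card (special_gaps S)"
proof -
  obtain p where "inj_on p G" "p ` G \<subseteq> special_gaps S"
    using irredundant_cover_private[OF assms(2)] .
  then show ?thesis using card_inj_on_le finite_special_gaps[OF assms(1)] by blast
qed

text \<open>Omitting the index \<open>i\<close> leaves some special gap uncovered, and this gap is
  private to \<open>F i\<close>; hence the family is injective and its length is the size of its
  image. Conversely, a proper subset of indices omits some \<open>i\<close>, and the private gap of
  \<open>F i\<close> then survives in the intersection.\<close>

lemma decomposition_iff_cover:
  assumes S: "numerical_semigroup S"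
  shows "(\<exists>F. irreducible_decomposition S k F) \<longleftrightarrow> (\<exists>G. irredundant_cover S G \<and> card G = k)"
proof
  assume "\<exists>F. irreducible_decomposition S k F"
  then obtain F where irr: "\<forall>i\<in>{1..k}. irreducible_semigroup (F i)"
    and eq: "S = (\<Inter>i\<in>{1..k}. F i)"
    and min: "\<And>I. I \<subset> {1..k} \<Longrightarrow> S \<noteq> (\<Inter>i\<in>I. F i)"
    by (auto simp: irreducible_decomposition_def)
  have F: "numerical_semigroup (F i) \<and> S \<subseteq> F i" if "i \<in> {1..k}" for i
    using irr eq that by (auto simp: irreducible_semigroup_def)
  have cover: "\<forall>h\<in>special_gaps S. \<exists>i\<in>{1..k}. h \<notin> F i"
    using Inter_eq_iff_special_gaps[OF S, of "{1..k}" F] F eq by simp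
  have priv: "\<exists>h\<in>special_gaps S. h \<notin> F i \<and> (\<forall>j\<in>{1..k} - {i}. h \<in> F j)" if i: "i \<in> {1..k}" for i
  proof -
    have "S \<noteq> (\<Inter>j\<in>{1..k} - {i}. F j)" using min[of "{1..k} - {i}"] i by blast
    moreover have "S = (\<Inter>j\<in>{1..k} - {i}. F j) \<longleftrightarrow>
        (\<forall>h\<in>special_gaps S. \<exists>j\<in>{1..k} - {i}. h \<notin> F j)"
      using F by (intro Inter_eq_iff_special_gaps[OF S]) auto
    ultimately have "\<exists>h\<in>special_gaps S. \<forall>j\<in>{1..k} - {i}. h \<in> F j" by simp
    then show ?thesis using cover by blast
  qed
  have "inj_on F {1..k}"
    by (intro inj_onI) (metis DiffI priv singletonD)
  then have "card (F ` {1..k}) = k" by (simp add: card_image)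
  moreover have "irredundant_cover S (F ` {1..k})"
    unfolding irredundant_cover_def
  proof (intro conjI ballI)
    show "finite (F ` {1..k})" by simp
    fix T assume "T \<in> F ` {1..k}"
    then obtain i where i: "i \<in> {1..k}" "T = F i" by blast
    then show "irreducible_semigroup T" "S \<subseteq> T" using irr F by blast+
    show "\<exists>h\<in>special_gaps S. h \<notin> T \<and> (\<forall>U\<in>F ` {1..k} - {T}. h \<in> U)"
      using priv[OF i(1)] i(2) by blast
  next
    fix h assume "h \<in> special_gaps S"
    then show "\<exists>T\<in>F ` {1..k}. h \<notin> T" using cover by blast
  qed
  ultimately show "\<exists>G. irredundant_cover S G \<and> card G = k" by blast
next
  assume "\<exists>G. irredundant_cover S G \<and> card G = k"
  then obtain G where G: "irredundant_cover S G" "card G = k" by blast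
  then have "finite G" by (simp add: irredundant_cover_def)
  then obtain F where "bij_betw F {1..k} G"
    using G(2) ex_bij_betw_nat_finite_1 by blast
  then have F: "inj_on F {1..k}" "F ` {1..k} = G" by (auto simp: bij_betw_def)
  have FG: "F i \<in> G" if "i \<in> {1..k}" for i using F(2) that by blast
  have irr: "irreducible_semigroup (F i)" "numerical_semigroup (F i) \<and> S \<subseteq> F i"
    if "i \<in> {1..k}" for i
    using FG[OF that] G(1) by (simp_all add: irredundant_cover_def irreducible_semigroup_def)
  have "\<forall>h\<in>special_gaps S. \<exists>i\<in>{1..k}. h \<notin> F i"
    using G(1) unfolding irredundant_cover_def F(2)[symmetric] by simp
  then have "S = (\<Inter>i\<in>{1..k}. F i)"
    using Inter_eq_iff_special_gaps[OF S, of "{1..k}" F] irr by simp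
  moreover have "S \<noteq> (\<Inter>i\<in>I. F i)" if I: "I \<subset> {1..k}" for I
  proof
    assume eq: "S = (\<Inter>i\<in>I. F i)"
    obtain i where i: "i \<in> {1..k}" "i \<notin> I" using I by blast
    then have "F i \<in> G" using FG by simp
    moreover have "\<forall>T\<in>G. \<exists>h\<in>special_gaps S. h \<notin> T \<and> (\<forall>U\<in>G - {T}. h \<in> U)"
      using G(1) unfolding irredundant_cover_def by (elim conjE)
    ultimately have "\<exists>h\<in>special_gaps S. h \<notin> F i \<and> (\<forall>U\<in>G - {F i}. h \<in> U)"
      by (rule bspec[rotated])
    then obtain h where h: "h \<in> special_gaps S" "\<forall>U\<in>G - {F i}. h \<in> U" by blast
    have "h \<in> F j" if "j \<in> I" for j
    proof -
      have j: "j \<in> {1..k}" "j \<noteq> i" using that i(2) I by auto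
      then have "F j \<noteq> F i" using inj_onD[OF F(1), of j i] i(1) by auto
      then show ?thesis using h(2) FG[OF j(1)] by simp
    qed
    then have "h \<in> S" by (subst eq) blast
    then show False using h by (simp add: special_gaps_def)
  qed
  ultimately have "irreducible_decomposition S k F"
    using irr(1) by (auto simp only: irreducible_decomposition_def)
  then show "\<exists>F. irreducible_decomposition S k F" by (intro exI)
qed

text \<open>One oversemigroup per special gap gives a cover, and a cover of least size is
  irredundant because no member can be removed.\<close>

lemma irredundant_cover_exists:
  assumes S: "numerical_semigroup S"
  shows "\<exists>G. irredundant_cover S G"
proof -
  define C where "C G \<longleftrightarrow> finite G \<and> (\<forall>T\<in>G. irreducible_semigroup T \<and> S \<subseteq> T) \<and>
     (\<forall>h\<in>special_gaps S. \<exists>T\<in>G. h \<notin> T)" for G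
  have "\<forall>h\<in>special_gaps S. \<exists>T. irreducible_semigroup T \<and> S \<subseteq> T \<and> h \<notin> T"
    using irreducible_extension[OF S] by (auto simp: special_gaps_def) metis
  then obtain t where "\<forall>h\<in>special_gaps S. irreducible_semigroup (t h) \<and> S \<subseteq> t h \<and> h \<notin> t h"
    by metis
  then have "C (t ` special_gaps S)"
    using finite_special_gaps[OF S] by (auto simp: C_def)
  then obtain G where G: "C G" "\<And>H. C H \<Longrightarrow> card G \<le> card H"
    using ex_has_least_nat[of C] by blast
  have "\<exists>h\<in>special_gaps S. h \<notin> T \<and> (\<forall>U\<in>G - {T}. h \<in> U)" if T: "T \<in> G" for T
  proof -
    have "card (G - {T}) < card G" using T G(1) by (intro card_Diff1_less) (simp_all add: C_def)
    then have "\<not> C (G - {T})" using G(2) by (metis not_less)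
    then show ?thesis using G(1) unfolding C_def by blast
  qed
  then show ?thesis using G(1) by (auto simp: irredundant_cover_def C_def)
qed

section \<open>Shortening a cover with as many members as special gaps\<close>

text \<open>The private gaps now exhaust all special gaps, and a member contains the private gaps of
  all the others.\<close>

lemma full_cover_singleton:
  assumes S: "numerical_semigroup S" and G: "irredundant_cover S G"
    and card: "card G = card (special_gaps S)" and h: "h \<in> special_gaps S"
  shows "\<exists>T\<in>G. special_gaps S - T = {h}"
proof -
  obtain p where p: "inj_on p G" "p ` G \<subseteq> special_gaps S" "\<And>T. T \<in> G \<Longrightarrow> p T \<notin> T"
    "\<And>T U. T \<in> G \<Longrightarrow> U \<in> G \<Longrightarrow> U \<noteq> T \<Longrightarrow> p T \<in> U"
    using irredundant_cover_private[OF G] by blast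
  have im: "p ` G = special_gaps S"
    using card_subset_eq[OF finite_special_gaps[OF S] p(2)] card_image[OF p(1)] card by simp
  then obtain T where T: "T \<in> G" "h = p T" using h by (metis imageE)
  have "x \<in> {h}" if "x \<in> special_gaps S - T" for x
  proof -
    have "x \<in> p ` G" using im that by simp
    then obtain U where "U \<in> G" "x = p U" by (rule imageE)
    then show ?thesis using p(4)[of U T] T that by auto
  qed
  then have "special_gaps S - T \<subseteq> {h}" by (rule subsetI)
  moreover have "h \<in> special_gaps S - T" using p(3)[OF T(1)] T(2) h by simp
  ultimately have "special_gaps S - T = {h}" by auto
  then show ?thesis by (rule bexI) (rule T(1))
qed

text \<open>\<open>T\<close> replaces both \<open>t a\<close> and \<open>t b\<close>. Its private
  gap is \<open>a\<close>, while every remaining \<open>t h\<close> keeps \<open>h\<close>.\<close>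

lemma merge_singletons:
  assumes S: "numerical_semigroup S"
    and t: "\<And>h. h \<in> special_gaps S \<Longrightarrow>
      irreducible_semigroup (t h) \<and> S \<subseteq> t h \<and> special_gaps S - t h = {h}"
    and T: "irreducible_semigroup T" "S \<subseteq> T" "special_gaps S - T = {a, b}" "a \<noteq> b"
  shows "\<exists>G. irredundant_cover S G \<and> card G = card (special_gaps S) - 1"
proof -
  define H where "H = special_gaps S - {a, b}"
  have H: "finite H" "H \<subseteq> special_gaps S" using finite_special_gaps[OF S] by (auto simp: H_def)
  have ab: "a \<in> special_gaps S" "b \<in> special_gaps S" using T by auto
  have "inj_on t H" using t H(2) by (intro inj_onI) (metis singleton_inject subsetD)
  moreover have notin: "T \<notin> t ` H"
  proof
    assume "T \<in> t ` H"
    then obtain h where "h \<in> H" "T = t h" by blast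
    then show False using t[of h] T(3,4) H(2) by auto
  qed
  \<comment> \<open>The lower bound 2 makes the truncated subtraction exact, so that adding
    \<open>T\<close> gives \<open>card (special_gaps S) - 1\<close>.\<close>
  moreover have "card H = card (special_gaps S) - 2" "2 \<le> card (special_gaps S)"
    using ab T(4) finite_special_gaps[OF S] card_mono[of "special_gaps S" "{a, b}"]
    by (simp_all add: H_def card_Diff_subset)
  ultimately have "card (insert T (t ` H)) = card (special_gaps S) - 1"
    using H by (simp add: card_image)
  moreover have "irredundant_cover S (insert T (t ` H))"
    unfolding irredundant_cover_def
  proof (intro conjI ballI)
    show "finite (insert T (t ` H))" using H by simp
    fix U assume U: "U \<in> insert T (t ` H)"
    then show "irreducible_semigroup U" "S \<subseteq> U" using t T H by blast+
    show "\<exists>h\<in>special_gaps S. h \<notin> U \<and> (\<forall>V\<in>insert T (t ` H) - {U}. h \<in> V)"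
    proof (cases "U = T")
      case True
      have "a \<in> t h" if "h \<in> H" for h using t[of h] that ab by (auto simp: H_def)
      then show ?thesis using True T ab by blast
    next
      case False
      then obtain h where h: "h \<in> H" "U = t h" using U by blast
      have "h \<in> T" using h T by (auto simp: H_def)
      moreover have "h \<in> t k" if "k \<in> H" "k \<noteq> h" for k using t[of k] that h(1) H(2)
        by (metis DiffI singletonD subsetD)
      moreover have "h \<notin> U" using t[of h] h H by blast
      ultimately show ?thesis using h H by blast
    qed
  next
    fix h assume h: "h \<in> special_gaps S"
    show "\<exists>U\<in>insert T (t ` H). h \<notin> U"
      using t[OF h] T(3) h by (cases "h \<in> H") (auto simp: H_def)
  qed
  ultimately show ?thesis by blast
qed

text \<open>If neither \<open>{1, 4}\<close> nor \<open>{2, 5}\<close> were fully represented, two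
  of the five nonzero residues would be absent, leaving at most three special gaps.\<close>

lemma antipodal_special_gaps:
  assumes S: "numerical_semigroup S" "6 \<in> S" and "4 \<le> card (special_gaps S)"
  obtains a b where "a \<in> special_gaps S" "b \<in> special_gaps S" "a \<noteq> b" "(a + 3) mod 6 = b mod 6"
proof -
  define R where "R = (\<lambda>h. h mod 6) ` special_gaps S"
  have R: "4 \<le> card R" "R \<subseteq> {1..5}"
    using special_gaps_mod_6[OF S] assms(3) by (simp_all add: R_def card_image)
  have "{1, 4} \<subseteq> R \<or> {2, 5} \<subseteq> R"
  proof (rule ccontr)
    assume "\<not> ?thesis"
    then obtain x y where "x \<in> {1, 4}" "y \<in> {2, 5}" "x \<notin> R" "y \<notin> R" by blast
    then have "R \<subseteq> {1..5} - {x, y}" "card ({1..5} - {x, y}) = 3"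
      using R by (auto simp: card_Diff_subset)
    then have "card R \<le> 3" by (metis card_mono finite_Diff finite_atLeastAtMost)
    then show False using R by simp
  qed
  then obtain a b where "a \<in> special_gaps S" "b \<in> special_gaps S"
    "a mod 6 = 1 \<and> b mod 6 = 4 \<or> a mod 6 = 2 \<and> b mod 6 = 5"
    unfolding R_def by fastforce
  moreover from this(3) have "a \<noteq> b" "(a + 3) mod 6 = b mod 6"
    by (auto simp: mod_add_left_eq[of a 6 3, symmetric])
  ultimately show thesis using that by blast
qed

lemma full_cover_shorten:
  assumes S: "numerical_semigroup S" "6 \<in> S" and G: "irredundant_cover S G"
    and card: "card G = card (special_gaps S)" "4 \<le> card G"
  shows "\<exists>G. irredundant_cover S G \<and> card G = card (special_gaps S) - 1"
proof -
  obtain t where t: "\<And>h. h \<in> special_gaps S \<Longrightarrow> t h \<in> G \<and> special_gaps S - t h = {h}"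
    using full_cover_singleton[OF S(1) G card(1)] by metis
  then have t': "irreducible_semigroup (t h) \<and> S \<subseteq> t h \<and> special_gaps S - t h = {h}"
    if "h \<in> special_gaps S" for h
    using G that by (auto simp: irredundant_cover_def)
  obtain a b where ab: "a \<in> special_gaps S" "b \<in> special_gaps S" "(a + 3) mod 6 = b mod 6" "a \<noteq> b"
    using antipodal_special_gaps[OF S] card by (metis (no_types))
  \<comment> \<open>Extending \<open>t a \<inter> t b\<close> instead of \<open>S\<close> keeps all
    other special gaps inside, so the extension misses exactly \<open>a\<close> and
    \<open>b\<close>.\<close>
  have "numerical_semigroup (t a \<inter> t b)"
    using t' ab by (auto simp: irreducible_semigroup_def intro!: numerical_semigroup_Int)
  moreover have "6 \<in> t a \<inter> t b" using t' ab S(2) by blast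
  moreover have "a \<notin> t a \<inter> t b" "b \<notin> t a \<inter> t b" using t ab by blast+
  ultimately obtain T where T: "irreducible_semigroup T" "t a \<inter> t b \<subseteq> T" "a \<notin> T" "b \<notin> T"
    using irreducible_missing_antipodal_pair ab(3) by metis
  have "h \<in> T" if "h \<in> special_gaps S" "h \<noteq> a" "h \<noteq> b" for h
    using t ab that T(2) by blast
  then have "special_gaps S - T = {a, b}" using ab T by blast
  moreover have "S \<subseteq> T" using T t' ab by blast
  ultimately show ?thesis using merge_singletons[OF S(1) t' T(1)] \<open>a \<noteq> b\<close> by blast
qed

section \<open>Five special gaps: semigroups missing a chosen pair\<close>

lemma special_gaps_mod_6_image:
  assumes S: "numerical_semigroup S" "6 \<in> S" and card: "card (special_gaps S) = 5"
  shows "(\<lambda>h. h mod 6) ` special_gaps S = {1..5}"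
  using card_subset_eq[OF _ special_gaps_mod_6(2)[OF S]] card
  by (simp add: card_image[OF special_gaps_mod_6(1)[OF S]])

text \<open>Every nonzero residue class contains a special gap \<open>k\<close>; take the one
  congruent to \<open>i + j\<close>. If \<open>i + j < k\<close>, then \<open>k\<close> is reached
  from \<open>i + j + 6 \<in> S\<close> by adding sixes, which is impossible; if
  \<open>i + j > k\<close>, then \<open>i + j\<close> is reached from
  \<open>k + 6 \<in> S\<close>.\<close>

lemma special_gaps_sum:
  assumes S: "numerical_semigroup S" "6 \<in> S" and card: "card (special_gaps S) = 5"
    and ij: "i \<in> special_gaps S" "j \<in> special_gaps S"
  shows "i + j \<in> S \<union> special_gaps S"
proof (cases "(i + j) mod 6 = 0")
  case True
  then show ?thesis using semigroup_mod_6[OF S semigroup_zero[OF S(1)]] by simp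
next
  case False
  have "(\<lambda>h. h mod 6) ` special_gaps S = {1..5}"
    by (rule special_gaps_mod_6_image[OF S card])
  moreover have "(i + j) mod 6 \<in> {1..5}"
    using False mod_less_divisor[of 6 "i + j"] unfolding atLeastAtMost_iff by linarith
  ultimately obtain k where k: "k \<in> special_gaps S" "(i + j) mod 6 = k mod 6"
    by (metis (no_types, lifting) imageE)
  have S6: "i + j + 6 \<in> S"
  proof -
    have "j + 6 \<in> S" using ij(2) S(2) by (auto simp: special_gaps_def)
    then have "i + (j + 6) \<in> S" using ij(1) by (auto simp: special_gaps_def)
    then show ?thesis by (simp add: add.assoc)
  qed
  have "k \<notin> S" using k by (simp add: special_gaps_def)
  consider "i + j = k" | "i + j < k" | "k < i + j" by linarith
  then show ?thesis
  proof cases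
    case 1
    then show ?thesis using k by simp
  next
    case 2
    then have "6 dvd k - (i + j)" using k(2) by (metis less_imp_le_nat mod_eq_dvd_iff_nat)
    then have "6 \<le> k - (i + j)" using 2 by (intro dvd_imp_le) auto
    then have "k \<in> S" using semigroup_mod_6[OF S S6, of k] k(2) by simp
    then show ?thesis using \<open>k \<notin> S\<close> by simp
  next
    case 3
    then have "6 dvd (i + j) - k" using k(2) by (metis less_imp_le_nat mod_eq_dvd_iff_nat)
    then have "6 \<le> (i + j) - k" using 3 by (intro dvd_imp_le) auto
    moreover have "k + 6 \<in> S" using k(1) S(2) by (auto simp: special_gaps_def)
    ultimately have "i + j \<in> S" using semigroup_mod_6[OF S, of "k + 6" "i + j"] k(2) by simp
    then show ?thesis by simp
  qed
qed

text \<open>Closure can fail only when a sum of two adjoined gaps hits a special gap that was left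
  out.\<close>

lemma adjoin_other_special_gaps:
  assumes S: "numerical_semigroup S" "6 \<in> S" and card: "card (special_gaps S) = 5"
    and J: "J \<subseteq> special_gaps S"
    and ab: "\<And>i j. i \<in> J \<Longrightarrow> j \<in> J \<Longrightarrow> i \<noteq> j \<Longrightarrow> i + j \<notin> special_gaps S - J"
  shows "numerical_semigroup (S \<union> J)"
proof (rule special_gaps_union[OF S(1) J])
  fix i j assume ij: "i \<in> J" "j \<in> J" "i \<noteq> j"
  then have "i + j \<in> S \<union> special_gaps S" using special_gaps_sum[OF S card] J by blast
  then show "i + j \<in> S \<union> J" using ab[OF ij] by blast
qed

text \<open>The residue of \<open>c\<^sub>k\<close> is \<open>k\<close> for all \<open>k\<close>, or \<open>-k\<close> for all \<open>k\<close>, so that reversing the labels is allowed.\<close>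

definition residue_labelling :: "nat set \<Rightarrow> nat \<Rightarrow> nat \<Rightarrow> nat \<Rightarrow> nat \<Rightarrow> nat \<Rightarrow> bool" where
  "residue_labelling S c1 c2 c3 c4 c5 \<longleftrightarrow>
     special_gaps S = {c1, c2, c3, c4, c5} \<and>
     (c1 mod 6 = 1 \<and> c2 mod 6 = 2 \<and> c3 mod 6 = 3 \<and> c4 mod 6 = 4 \<and> c5 mod 6 = 5 \<or>
      c1 mod 6 = 5 \<and> c2 mod 6 = 4 \<and> c3 mod 6 = 3 \<and> c4 mod 6 = 2 \<and> c5 mod 6 = 1)"

lemma residue_labelling_exists:
  assumes S: "numerical_semigroup S" "6 \<in> S" and card: "card (special_gaps S) = 5"
  obtains c1 c2 c3 c4 c5 where "residue_labelling S c1 c2 c3 c4 c5"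
proof -
  have im: "(\<lambda>h. h mod 6) ` special_gaps S = {1..5}"
    by (rule special_gaps_mod_6_image[OF S card])
  have "\<exists>h\<in>special_gaps S. h mod 6 = r" if "r \<in> {1..5}" for r
    using that unfolding im[symmetric] by blast
  then obtain c where c: "\<And>r. r \<in> {1..5} \<Longrightarrow> c r \<in> special_gaps S \<and> c r mod 6 = r"
    by metis
  have "c ` {1..5} = special_gaps S"
  proof (rule card_subset_eq[OF finite_special_gaps[OF S(1)]])
    have "inj_on c {1..5}" using c by (intro inj_onI) metis
    then show "card (c ` {1..5}) = card (special_gaps S)" using card by (simp add: card_image)
  qed (use c in blast)
  moreover have "{1..5::nat} = {1, 2, 3, 4, 5}" by auto
  ultimately have "special_gaps S = {c 1, c 2, c 3, c 4, c 5}" by simp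
  moreover have "c 1 mod 6 = 1" "c 2 mod 6 = 2" "c 3 mod 6 = 3" "c 4 mod 6 = 4" "c 5 mod 6 = 5"
    using c by simp_all
  ultimately show thesis
    using that[of "c 1" "c 2" "c 3" "c 4" "c 5"] by (simp add: residue_labelling_def)
qed

lemma residue_labelling_rev:
  "residue_labelling S c1 c2 c3 c4 c5 \<Longrightarrow> residue_labelling S c5 c4 c3 c2 c1"
  by (auto simp: residue_labelling_def)

lemma residue_labelling_distinct:
  assumes "residue_labelling S c1 c2 c3 c4 c5"
  shows "distinct [c1, c2, c3, c4, c5]"
  using assms by (auto simp: residue_labelling_def)

lemma sum_neq_if_mod_neq:
  fixes x y z n :: nat
  assumes "(x mod n + y mod n) mod n \<noteq> z mod n"
  shows "x + y \<noteq> z"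
  using assms by (metis mod_add_eq)

text \<open>Among the sums of two of \<open>c2\<close>, \<open>c3\<close>, \<open>c5\<close>,
  residues allow only \<open>c2 + c5\<close> to equal an omitted gap, namely \<open>c1\<close>. Once
  these three are adjoined, \<open>c1\<close> and \<open>c4\<close> form an antipodal pair.\<close>

lemma labelled_missing_14:
  assumes S: "numerical_semigroup S" "6 \<in> S" and card: "card (special_gaps S) = 5"
    and lab: "residue_labelling S c1 c2 c3 c4 c5" and "c2 + c5 \<noteq> c1"
  obtains T where "irreducible_semigroup T" "S \<subseteq> T" "special_gaps S - T = {c1, c4}"
proof -
  define J where "J = {c2, c3, c5}"
  have sg: "special_gaps S = {c1, c2, c3, c4, c5}"
    and res: "c1 mod 6 = 1 \<and> c2 mod 6 = 2 \<and> c3 mod 6 = 3 \<and> c4 mod 6 = 4 \<and> c5 mod 6 = 5 \<or>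
      c1 mod 6 = 5 \<and> c2 mod 6 = 4 \<and> c3 mod 6 = 3 \<and> c4 mod 6 = 2 \<and> c5 mod 6 = 1"
    using lab by (simp_all add: residue_labelling_def)
  have dist: "distinct [c1, c2, c3, c4, c5]" by (rule residue_labelling_distinct[OF lab])
  have mem: "c1 \<in> special_gaps S" "c2 \<in> special_gaps S" "c3 \<in> special_gaps S"
    "c4 \<in> special_gaps S" "c5 \<in> special_gaps S"
    using sg by simp_all
  have gaps: "c1 \<notin> S" "c4 \<notin> S"
    using special_gapD(1) mem by blast+
  have "c2 + c3 \<noteq> c1" "c2 + c3 \<noteq> c4" "c3 + c5 \<noteq> c1" "c3 + c5 \<noteq> c4" "c2 + c5 \<noteq> c4"
    by (rule sum_neq_if_mod_neq[of _ 6]; (use res in auto))+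
  then have "numerical_semigroup (S \<union> J)"
    using dist \<open>c2 + c5 \<noteq> c1\<close>
    by (intro adjoin_other_special_gaps[OF S card]) (auto simp: sg J_def add.commute)
  moreover have "(c1 + 3) mod 6 = c4 mod 6"
    unfolding mod_add_left_eq[of c1 6 3, symmetric] using res by auto
  moreover have "c1 \<notin> S \<union> J" "c4 \<notin> S \<union> J" using gaps dist by (auto simp: J_def)
  ultimately obtain T where T: "irreducible_semigroup T" "S \<union> J \<subseteq> T" "c1 \<notin> T" "c4 \<notin> T"
    using irreducible_missing_antipodal_pair[of "S \<union> J" c1 c4] S(2) by blast
  have "special_gaps S - T = {c1, c4}"
    using T unfolding sg J_def by auto
  then show thesis using that T by blast
qed

text \<open>With \<open>c5\<close> adjoined, the relation \<open>c2 + c5 = c1\<close> forces any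
  extension missing \<open>c1\<close> to miss \<open>c2\<close>. The sum \<open>c3 + c5\<close> is
  not \<open>c2\<close>, for otherwise \<open>c1 = c3 + (c5 + c5)\<close> would lie in
  \<open>S\<close>.\<close>

lemma labelled_missing_12:
  assumes S: "numerical_semigroup S" "6 \<in> S" and card: "card (special_gaps S) = 5"
    and lab: "residue_labelling S c1 c2 c3 c4 c5" and "c2 + c5 = c1" "c3 + c4 \<noteq> c1"
  obtains T where "irreducible_semigroup T" "S \<subseteq> T" "special_gaps S - T = {c1, c2}"
proof -
  define J where "J = {c3, c4, c5}"
  have sg: "special_gaps S = {c1, c2, c3, c4, c5}"
    and res: "c1 mod 6 = 1 \<and> c2 mod 6 = 2 \<and> c3 mod 6 = 3 \<and> c4 mod 6 = 4 \<and> c5 mod 6 = 5 \<or>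
      c1 mod 6 = 5 \<and> c2 mod 6 = 4 \<and> c3 mod 6 = 3 \<and> c4 mod 6 = 2 \<and> c5 mod 6 = 1"
    using lab by (simp_all add: residue_labelling_def)
  have dist: "distinct [c1, c2, c3, c4, c5]" by (rule residue_labelling_distinct[OF lab])
  have mem: "c1 \<in> special_gaps S" "c2 \<in> special_gaps S" "c3 \<in> special_gaps S"
    "c4 \<in> special_gaps S" "c5 \<in> special_gaps S"
    using sg by simp_all
  have gaps: "c1 \<notin> S" "c2 \<notin> S"
    using special_gapD(1) mem by blast+
  have "c3 + c5 \<noteq> c2"
  proof
    assume "c3 + c5 = c2"
    then have "c1 = c3 + (c5 + c5)" using \<open>c2 + c5 = c1\<close> by simp
    moreover have "c5 + c5 \<in> S" "0 < c5 + c5"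
      using special_gapD(2)[OF mem(5)] res by (auto intro: gr0I)
    then have "c3 + (c5 + c5) \<in> S" by (rule special_gapD(3)[OF mem(3)])
    ultimately show False using gaps by simp
  qed
  moreover have "c3 + c4 \<noteq> c2" "c3 + c5 \<noteq> c1" "c4 + c5 \<noteq> c1" "c4 + c5 \<noteq> c2"
    by (rule sum_neq_if_mod_neq[of _ 6]; (use res in auto))+
  ultimately have "numerical_semigroup (S \<union> J)"
    using dist \<open>c3 + c4 \<noteq> c1\<close>
    by (intro adjoin_other_special_gaps[OF S card]) (auto simp: sg J_def add.commute)
  moreover have "c1 \<notin> S \<union> J" using gaps dist by (auto simp: J_def)
  ultimately obtain T where T: "irreducible_semigroup T" "S \<union> J \<subseteq> T" "c1 \<notin> T"
    using irreducible_extension by blast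
  have "c2 \<notin> T"
  proof
    assume "c2 \<in> T"
    moreover have "c5 \<in> T" using T by (auto simp: J_def)
    ultimately have "c2 + c5 \<in> T"
      using T(1) by (auto simp: irreducible_semigroup_def intro: semigroup_add)
    then show False using T \<open>c2 + c5 = c1\<close> by simp
  qed
  then have "special_gaps S - T = {c1, c2}"
    using T unfolding sg J_def by auto
  then show thesis using that T by blast
qed

text \<open>The labels 3 and 5 are not antipodal, so parity replaces the argument modulo 3:
  \<open>c3\<close> and \<open>c5\<close> are odd, their difference is even, and the descent from
  the smaller one meets only odd numbers.\<close>

lemma labelled_missing_35:
  assumes S: "numerical_semigroup S" "6 \<in> S" and card: "card (special_gaps S) = 5"
    and lab: "residue_labelling S c1 c2 c3 c4 c5" and "c2 + c5 = c1"
  obtains T where "irreducible_semigroup T" "S \<subseteq> T" "special_gaps S - T = {c3, c5}"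
proof -
  define J where "J = {c1, c2, c4}"
  have sg: "special_gaps S = {c1, c2, c3, c4, c5}"
    and res: "c1 mod 6 = 1 \<and> c2 mod 6 = 2 \<and> c3 mod 6 = 3 \<and> c4 mod 6 = 4 \<and> c5 mod 6 = 5 \<or>
      c1 mod 6 = 5 \<and> c2 mod 6 = 4 \<and> c3 mod 6 = 3 \<and> c4 mod 6 = 2 \<and> c5 mod 6 = 1"
    using lab by (simp_all add: residue_labelling_def)
  have dist: "distinct [c1, c2, c3, c4, c5]" by (rule residue_labelling_distinct[OF lab])
  have mem: "c1 \<in> special_gaps S" "c2 \<in> special_gaps S" "c3 \<in> special_gaps S"
    "c4 \<in> special_gaps S" "c5 \<in> special_gaps S"
    using sg by simp_all
  have gaps: "c1 \<notin> S" "c3 \<notin> S" "c5 \<notin> S"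
    using special_gapD(1) mem by blast+
  have "0 < c2" using res by (intro gr0I) auto
  then have "c5 < c1" using \<open>c2 + c5 = c1\<close> by simp
  have "c1 + c2 \<noteq> c3"
  proof
    assume "c1 + c2 = c3"
    then have "c3 = c5 + (c2 + c2)" using \<open>c2 + c5 = c1\<close> by simp
    moreover have "c2 + c2 \<in> S" by (rule special_gapD(2)[OF mem(2)])
    then have "c5 + (c2 + c2) \<in> S" using special_gapD(3)[OF mem(5)] \<open>0 < c2\<close> by simp
    ultimately show False using gaps by simp
  qed
  moreover have "c1 + c4 \<noteq> c5" using \<open>c5 < c1\<close> by simp
  moreover have "c1 + c2 \<noteq> c5" "c1 + c4 \<noteq> c3" "c2 + c4 \<noteq> c3" "c2 + c4 \<noteq> c5"
    by (rule sum_neq_if_mod_neq[of _ 6]; (use res in auto))+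
  ultimately have SJ: "numerical_semigroup (S \<union> J)"
    using dist
    by (intro adjoin_other_special_gaps[OF S card]) (auto simp: sg J_def add.commute)
  have par: "even x \<longleftrightarrow> even (x mod 6)" for x :: nat by (simp add: dvd_mod_iff)
  have parity: "odd c1" "odd c3" "odd c5" "even c2" "even c4"
    unfolding par[of c1] par[of c2] par[of c3] par[of c4] par[of c5] using res by auto
  \<comment> \<open>An odd \<open>s\<close> in this range is none of \<open>c1\<close>,
    \<open>c2\<close>, \<open>c4\<close>: the first is too large, the others are even. Each odd
    residue class has a gap among \<open>c1\<close>, \<open>c3\<close>, \<open>c5\<close> that is at
    least \<open>s\<close>, so \<open>s \<in> S\<close> would put a gap into
    \<open>S\<close>.\<close>
  have low: "s \<notin> S \<union> J" if s: "odd s" "s \<le> c3" "s \<le> c5" for s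
  proof
    assume "s \<in> S \<union> J"
    then have "s \<in> S" using s \<open>c5 < c1\<close> parity by (auto simp: J_def)
    have "s mod 6 = 1 \<or> s mod 6 = 3 \<or> s mod 6 = 5" using \<open>odd s\<close> by presburger
    then have "s mod 6 = c1 mod 6 \<or> s mod 6 = c3 mod 6 \<or> s mod 6 = c5 mod 6"
      using res by auto
    then show False
      using semigroup_mod_6[OF S \<open>s \<in> S\<close>] s \<open>c5 < c1\<close> gaps by (meson le_trans less_imp_le_nat)
  qed
  have notin: "c3 \<notin> S \<union> J" "c5 \<notin> S \<union> J" using gaps dist by (auto simp: J_def)
  have "\<exists>T. irreducible_semigroup T \<and> S \<union> J \<subseteq> T \<and> a \<notin> T \<and> b \<notin> T"
    if "b < a" "{a, b} = {c3, c5}" for a b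
  proof -
    have ab: "odd a" "odd b" "b \<le> c3" "b \<le> c5" "a \<notin> S \<union> J" "b \<notin> S \<union> J"
      using that parity notin by (auto simp: doubleton_eq_iff)
    have "b - m * (a - b) \<notin> S \<union> J" if "m * (a - b) \<le> b" for m
      using that ab \<open>b < a\<close> by (intro low) (auto simp: le_diff_conv)
    then show ?thesis using irreducible_missing_pair[OF SJ, of a b] ab \<open>b < a\<close> by metis
  qed
  moreover have "c5 < c3 \<or> c3 < c5" using dist by (auto simp: neq_iff)
  ultimately obtain T where T: "irreducible_semigroup T" "S \<union> J \<subseteq> T" "c3 \<notin> T" "c5 \<notin> T"
    by (metis insert_commute)
  have "special_gaps S - T = {c3, c5}"
    using T unfolding sg J_def by auto
  then show thesis using that T by blast
qed

section \<open>From four members to three when there are five special gaps\<close>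

text \<open>\<open>T\<close> contains the private gaps of all other members. With five gaps and four
  members, each member therefore misses at most two.\<close>

lemma irredundant_cover_missed_le:
  assumes S: "numerical_semigroup S" and G: "irredundant_cover S G" and T: "T \<in> G"
  shows "card (special_gaps S - T) + card G \<le> card (special_gaps S) + 1"
proof -
  obtain p where p: "inj_on p G" "p ` G \<subseteq> special_gaps S" "\<And>T. T \<in> G \<Longrightarrow> p T \<notin> T"
    "\<And>T U. T \<in> G \<Longrightarrow> U \<in> G \<Longrightarrow> U \<noteq> T \<Longrightarrow> p T \<in> U"
    using irredundant_cover_private[OF G] by blast
  have fin: "finite (special_gaps S)" "finite G"
    using finite_special_gaps[OF S] G by (simp_all add: irredundant_cover_def)
  have "p ` (G - {T}) \<subseteq> special_gaps S \<inter> T" using p(2,4) T by blast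
  then have "card (p ` (G - {T})) \<le> card (special_gaps S \<inter> T)"
    using fin by (intro card_mono) auto
  moreover have "card (p ` (G - {T})) = card G - 1"
    using p(1) T by (subst card_image) (auto intro: inj_on_diff)
  moreover have "card (special_gaps S) = card (special_gaps S \<inter> T) + card (special_gaps S - T)"
    using fin by (metis card_Int_Diff)
  ultimately show ?thesis by linarith
qed

text \<open>\<open>Z\<close> misses at most one gap besides \<open>e\<close>, so it contains one of
  \<open>a\<close>, \<open>b\<close> and one of \<open>c\<close>, \<open>d\<close>; these are
  private to \<open>T\<close> and \<open>U\<close>, and \<open>e\<close> is private to
  \<open>Z\<close>.\<close>

lemma cover_of_two_pairs:
  assumes sg: "special_gaps S = {a, b, c, d, e}" and dist: "distinct [a, b, c, d, e]"
    and T: "irreducible_semigroup T" "S \<subseteq> T" "special_gaps S - T = {a, b}"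
    and U: "irreducible_semigroup U" "S \<subseteq> U" "special_gaps S - U = {c, d}"
    and Z: "irreducible_semigroup Z" "S \<subseteq> Z" "e \<notin> Z" "card (special_gaps S - Z) \<le> 2"
  shows "\<exists>G. irredundant_cover S G \<and> card G = 3"
proof -
  have memT: "a \<notin> T" "b \<notin> T" "c \<in> T" "d \<in> T" "e \<in> T"
  proof -
    have *: "h \<in> T \<longleftrightarrow> h \<notin> {a, b}" if "h \<in> special_gaps S" for h
      using that unfolding T(3)[symmetric] by simp
    show "a \<notin> T" "b \<notin> T" "c \<in> T" "d \<in> T" "e \<in> T"
      using *[of a] *[of b] *[of c] *[of d] *[of e] dist by (auto simp: sg)
  qed
  have memU: "c \<notin> U" "d \<notin> U" "a \<in> U" "b \<in> U" "e \<in> U"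
  proof -
    have *: "h \<in> U \<longleftrightarrow> h \<notin> {c, d}" if "h \<in> special_gaps S" for h
      using that unfolding U(3)[symmetric] by simp
    show "c \<notin> U" "d \<notin> U" "a \<in> U" "b \<in> U" "e \<in> U"
      using *[of a] *[of b] *[of c] *[of d] *[of e] dist by (auto simp: sg)
  qed
  have Z2: "x \<in> Z \<or> y \<in> Z" if "x \<in> special_gaps S" "y \<in> special_gaps S" "x \<noteq> y" "x \<noteq> e" "y \<noteq> e" for x y
  proof (rule ccontr)
    assume "\<not> ?thesis"
    then have "{x, y, e} \<subseteq> special_gaps S - Z" using that Z(3) sg by auto
    then have "card {x, y, e} \<le> card (special_gaps S - Z)"
      unfolding sg by (intro card_mono) auto
    then show False using that Z(4) by simp
  qed
  obtain x where x: "x \<in> special_gaps S" "x \<notin> T" "x \<in> U" "x \<in> Z"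
    using Z2[of a b] memT memU dist sg by auto
  obtain y where y: "y \<in> special_gaps S" "y \<in> T" "y \<notin> U" "y \<in> Z"
    using Z2[of c d] memT memU dist sg by auto
  have e: "e \<in> special_gaps S" using sg by simp
  have "T \<noteq> U" "T \<noteq> Z" "U \<noteq> Z" using x y by auto
  then have "card {T, U, Z} = 3" by simp
  moreover have "irredundant_cover S {T, U, Z}"
    unfolding irredundant_cover_def
  proof (intro conjI)
    show "\<forall>V\<in>{T, U, Z}. irreducible_semigroup V \<and> S \<subseteq> V" using T U Z by simp
    show "\<forall>h\<in>special_gaps S. \<exists>V\<in>{T, U, Z}. h \<notin> V" using memT memU Z(3) unfolding sg by simp
    have "\<exists>h\<in>special_gaps S. h \<notin> T \<and> (\<forall>V\<in>{T, U, Z} - {T}. h \<in> V)" using x by auto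
    moreover have "\<exists>h\<in>special_gaps S. h \<notin> U \<and> (\<forall>V\<in>{T, U, Z} - {U}. h \<in> V)" using y by auto
    moreover have "\<exists>h\<in>special_gaps S. h \<notin> Z \<and> (\<forall>V\<in>{T, U, Z} - {Z}. h \<in> V)"
      using e memT memU Z(3) by auto
    ultimately show "\<forall>V\<in>{T, U, Z}. \<exists>h\<in>special_gaps S. h \<notin> V \<and> (\<forall>W\<in>{T, U, Z} - {V}. h \<in> W)"
      by simp
  qed simp
  ultimately show ?thesis by blast
qed

text \<open>The pairs are \<open>{c1, c2}\<close> and \<open>{c3, c5}\<close>, with
  \<open>c4\<close> left over. The four-member cover enters twice: it excludes
  \<open>c3 + c4 = c1\<close>, and it supplies the member missing \<open>c4\<close>.\<close>

lemma labelled_related_cover: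
  assumes S: "numerical_semigroup S" "6 \<in> S" and card: "card (special_gaps S) = 5"
    and G: "irredundant_cover S G" "card G = 4"
    and lab: "residue_labelling S c1 c2 c3 c4 c5" and rel: "c2 + c5 = c1"
  shows "\<exists>G. irredundant_cover S G \<and> card G = 3"
proof -
  have sg: "special_gaps S = {c1, c2, c3, c4, c5}" using lab by (simp add: residue_labelling_def)
  have dist: "distinct [c1, c2, c3, c4, c5]" by (rule residue_labelling_distinct[OF lab])
  have GD: "irreducible_semigroup Z" "S \<subseteq> Z" "card (special_gaps S - Z) \<le> 2" if "Z \<in> G" for Z
    using that G irredundant_cover_missed_le[OF S(1) G(1) that] card
    by (simp_all add: irredundant_cover_def)
  have cov: "\<exists>Z\<in>G. h \<notin> Z" if "h \<in> special_gaps S" for h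
    using that G(1) by (simp add: irredundant_cover_def)
  have "c3 + c4 \<noteq> c1"
  proof
    \<comment> \<open>A member missing \<open>c1\<close> would miss three special gaps.\<close>
    assume rel': "c3 + c4 = c1"
    obtain Z where Z: "Z \<in> G" "c1 \<notin> Z" using cov[of c1] sg by auto
    have add: "x \<in> Z \<Longrightarrow> y \<in> Z \<Longrightarrow> x + y \<in> Z" for x y
      using GD(1)[OF Z(1)] by (simp add: irreducible_semigroup_def semigroup_add)
    obtain x where x: "x \<in> {c2, c5}" "x \<notin> Z" using add[of c2 c5] rel Z(2) by auto
    obtain y where y: "y \<in> {c3, c4}" "y \<notin> Z" using add[of c3 c4] rel' Z(2) by auto
    have "{c1, x, y} \<subseteq> special_gaps S - Z" using x y Z(2) sg by auto
    then have "card {c1, x, y} \<le> card (special_gaps S - Z)"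
      unfolding sg by (intro card_mono) auto
    moreover have "card {c1, x, y} = 3" using x(1) y(1) dist by auto
    ultimately show False using GD(3)[OF Z(1)] by simp
  qed
  then obtain T where T: "irreducible_semigroup T" "S \<subseteq> T" "special_gaps S - T = {c1, c2}"
    using labelled_missing_12[OF S card lab rel] by blast
  obtain U where U: "irreducible_semigroup U" "S \<subseteq> U" "special_gaps S - U = {c3, c5}"
    using labelled_missing_35[OF S card lab rel] by blast
  obtain Z where Z: "Z \<in> G" "c4 \<notin> Z" using cov[of c4] sg by auto
  have "special_gaps S = {c1, c2, c3, c5, c4}" using sg by auto
  moreover have "distinct [c1, c2, c3, c5, c4]" using dist by auto
  ultimately show ?thesis
    using cover_of_two_pairs[OF _ _ T U GD(1,2)[OF Z(1)] Z(2) GD(3)[OF Z(1)]] by blast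
qed

lemma four_cover_of_five_shorten:
  assumes S: "numerical_semigroup S" "6 \<in> S" and card: "card (special_gaps S) = 5"
    and G: "irredundant_cover S G" "card G = 4"
  shows "\<exists>G. irredundant_cover S G \<and> card G = 3"
proof -
  obtain c1 c2 c3 c4 c5 where lab: "residue_labelling S c1 c2 c3 c4 c5"
    using residue_labelling_exists[OF S card] by blast
  \<comment> \<open>Under the reversed labels, \<open>c4 + c1 = c5\<close> takes the form of
    \<open>c2 + c5 = c1\<close>, and the pair \<open>{c1, c4}\<close> becomes
    \<open>{c5, c2}\<close>.\<close>
  note lab' = residue_labelling_rev[OF lab]
  consider "c2 + c5 = c1" | "c4 + c1 = c5" | "c2 + c5 \<noteq> c1" "c4 + c1 \<noteq> c5" by blast
  then show ?thesis
  proof cases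
    case 1
    then show ?thesis by (rule labelled_related_cover[OF S card G lab])
  next
    case 2
    then show ?thesis by (rule labelled_related_cover[OF S card G lab'])
  next
    case 3
    have sg: "special_gaps S = {c1, c4, c5, c2, c3}" using lab by (auto simp: residue_labelling_def)
    have dist: "distinct [c1, c4, c5, c2, c3]" using residue_labelling_distinct[OF lab] by auto
    obtain T where T: "irreducible_semigroup T" "S \<subseteq> T" "special_gaps S - T = {c1, c4}"
      using labelled_missing_14[OF S card lab 3(1)] by blast
    obtain U where U: "irreducible_semigroup U" "S \<subseteq> U" "special_gaps S - U = {c5, c2}"
      using labelled_missing_14[OF S card lab' 3(2)] by blast
    obtain Z where Z: "Z \<in> G" "c3 \<notin> Z" using G(1) sg by (auto simp: irredundant_cover_def)
    have "irreducible_semigroup Z" "S \<subseteq> Z" "card (special_gaps S - Z) \<le> 2"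
      using Z(1) G irredundant_cover_missed_le[OF S(1) G(1) Z(1)] card
      by (simp_all add: irredundant_cover_def)
    then show ?thesis using cover_of_two_pairs[OF sg dist T U _ _ Z(2)] by blast
  qed
qed

section \<open>The set of decomposition lengths\<close>

text \<open>Two special gaps \<open>h\<close> and \<open>k\<close> would exhibit \<open>S\<close> as
  the intersection of \<open>S \<union> {h}\<close> and \<open>S \<union> {k}\<close>.\<close>

lemma irreducible_card_special_gaps_le:
  assumes "irreducible_semigroup S"
  shows "card (special_gaps S) \<le> 1"
proof -
  have S: "numerical_semigroup S" using assms by (simp add: irreducible_semigroup_def)
  have "h = k" if hk: "h \<in> special_gaps S" "k \<in> special_gaps S" for h k
  proof (rule ccontr)
    assume "h \<noteq> k"
    have "numerical_semigroup (S \<union> {x})" if "x \<in> special_gaps S" for x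
      by (rule special_gaps_union[OF S]) (use that in auto)
    then have "numerical_semigroup (S \<union> {h})" "numerical_semigroup (S \<union> {k})"
      using hk by blast+
    moreover have "S \<subset> S \<union> {h}" "S \<subset> S \<union> {k}" using hk by (auto simp: special_gaps_def)
    moreover have "S = (S \<union> {h}) \<inter> (S \<union> {k})" using \<open>h \<noteq> k\<close> by blast
    ultimately show False using assms unfolding irreducible_semigroup_def by blast
  qed
  then show ?thesis using finite_special_gaps[OF S] by (simp add: card_le_Suc0_iff_eq)
qed

theorem theorem3p5:
  fixes S :: "nat set"
  assumes "numerical_semigroup S"
    and "multiplicity S = 6"
  shows "((\<exists>F. irreducible_decomposition S 5 F) \<longrightarrow> (\<exists>F. irreducible_decomposition S 4 F))
    \<and> ((\<exists>F. irreducible_decomposition S 4 F) \<longrightarrow> (\<exists>F. irreducible_decomposition S 3 F))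
    \<and> integer_interval (int ` decomposition_lengths S)"
proof -
  note S = assms(1)
  \<comment> \<open>A positive element must be exhibited before the \<open>LEAST\<close> in
    \<open>multiplicity\<close> has its defining property.\<close>
  have "infinite S" using semigroup_finite[OF S] finite_compl infinite_UNIV_nat by blast
  then have "\<not> S \<subseteq> {0}" using finite_subset by blast
  then obtain n where "n \<in> S" "0 < n" by auto
  then have S6: "6 \<in> S" and mult: "\<And>n. n \<in> S \<Longrightarrow> 0 < n \<Longrightarrow> 6 \<le> n"
    using LeastI[of "\<lambda>n. n \<in> S \<and> 0 < n" n] Least_le[of "\<lambda>n. n \<in> S \<and> 0 < n"] assms(2)
    by (auto simp: multiplicity_def)
  note iff = decomposition_iff_cover[OF S]
  define L where "L = decomposition_lengths S"
  have L: "k \<in> L \<longleftrightarrow> (\<exists>G. irredundant_cover S G \<and> card G = k)" for k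
    unfolding L_def decomposition_lengths_def mem_Collect_eq by (rule iff)
  have le: "k \<le> card (special_gaps S)" if "k \<in> L" for k
    using that irredundant_cover_card_le[OF S] unfolding L by blast
  have le5: "card (special_gaps S) \<le> 5" by (rule card_special_gaps_le[OF S S6])
  have 54: "4 \<in> L" if "5 \<in> L"
  proof -
    have "card (special_gaps S) = 5" using le[OF that] le5 by simp
    moreover obtain G where "irredundant_cover S G" "card G = 5" using \<open>5 \<in> L\<close> unfolding L by blast
    ultimately show ?thesis using full_cover_shorten[OF S S6, of G] by (simp add: L)
  qed
  have 43: "3 \<in> L" if "4 \<in> L"
  proof -
    obtain G where G: "irredundant_cover S G" "card G = 4" using \<open>4 \<in> L\<close> unfolding L by blast
    consider "card (special_gaps S) = 4" | "card (special_gaps S) = 5"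
      using le[OF \<open>4 \<in> L\<close>] le5 by linarith
    then show ?thesis
    proof cases
      case 1
      then show ?thesis using full_cover_shorten[OF S S6 G(1)] G(2) by (simp add: L)
    next
      case 2
      then show ?thesis using four_cover_of_five_shorten[OF S S6 _ G] by (simp add: L)
    qed
  qed
  \<comment> \<open>The empty intersection is \<open>UNIV\<close>, whose multiplicity is 1.\<close>
  have 0: "0 \<notin> L"
  proof
    assume "0 \<in> L"
    then obtain F where "irreducible_decomposition S 0 F"
      unfolding L_def decomposition_lengths_def by blast
    then have "S = UNIV" by (simp add: irreducible_decomposition_def)
    then show False using mult[of 1] by simp
  qed
  \<comment> \<open>Length 1 makes \<open>S\<close> irreducible, so there is at most one special gap
    and no longer decomposition.\<close>
  have 1: "k \<le> 1" if "1 \<in> L" "k \<in> L" for k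
  proof -
    obtain F where "irreducible_decomposition S 1 F"
      using \<open>1 \<in> L\<close> unfolding L_def decomposition_lengths_def by blast
    then have "irreducible_semigroup S" by (simp add: irreducible_decomposition_def)
    then show ?thesis using le[OF that(2)] irreducible_card_special_gaps_le by fastforce
  qed
  have "\<exists>k. k \<in> L" using irredundant_cover_exists[OF S] unfolding L by blast
  have bound: "1 \<le> k \<and> k \<le> 5" if "k \<in> L" for k
    using le[OF that] le5 0 that by (metis One_nat_def Suc_leI gr0I le_trans)
  \<comment> \<open>A length strictly between two others has \<open>k \<ge> 2\<close> below it and
    \<open>m \<le> 5\<close> above it, so it is 3 or 4 and is reached from \<open>m\<close> by the
    two shortening steps.\<close>
  have conv: "n \<in> L" if "k \<in> L" "m \<in> L" "k \<le> n" "n \<le> m" for k n m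
  proof (cases "k = n \<or> n = m")
    case False
    then have "k < n" "n < m" using that by auto
    moreover have "k \<noteq> 1" using 1[OF _ \<open>m \<in> L\<close>] \<open>k \<in> L\<close> \<open>k < n\<close> \<open>n < m\<close> by fastforce
    ultimately have "n = 3 \<and> m = 4 \<or> n = 3 \<and> m = 5 \<or> n = 4 \<and> m = 5"
      using bound[OF that(1)] bound[OF that(2)] by linarith
    then show ?thesis using 54 43 \<open>m \<in> L\<close> by auto
  qed (use that in auto)
  have fin: "finite L" using bound by (intro finite_subset[of L "{1..5}"]) auto
  have ne: "L \<noteq> {}" using \<open>\<exists>k. k \<in> L\<close> by blast
  have "int ` L = {n. int (Min L) \<le> n \<and> n \<le> int (Max L)}"
  proof safe
    fix k assume "k \<in> L"
    then show "int (Min L) \<le> int k" "int k \<le> int (Max L)" using fin by simp_all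
  next
    fix n assume n: "int (Min L) \<le> n" "n \<le> int (Max L)"
    then have "nat n \<in> L"
      using conv[OF Min_in[OF fin ne] Max_in[OF fin ne], of "nat n"] by simp
    moreover have "n = int (nat n)" using n by simp
    ultimately show "n \<in> int ` L" by blast
  qed
  moreover have "int (Min L) \<le> int (Max L)" using Min_in[OF fin ne] fin by simp
  ultimately have "integer_interval (int ` L)" unfolding integer_interval_def by blast
  then show ?thesis using 54 43 unfolding L_def decomposition_lengths_def by blast
qed

end
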